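(* Let $(X,\sigma)$ be a subshift of $\Sigma=A^{\mathbb Z}$ with finite separation numbers. Then the lower and upper box dimensions of the subset $[X]$ of $[\Sigma]$ (equipped with the metric $D_\delta$) are independent of $\delta\in(0,1]$. Further, $$\underline{\mathrm{ac}}\big(\sigma|_X\big)=\underline{\dim}_B([X])\qquad\text{and}\qquad\overline{\mathrm{ac}}\big(\sigma|_X\big)=\overline{\dim}_B([X]).$$
   Context: $A$ is a finite alphabet, $\Sigma=A^{\mathbb Z}$ carries the product topology, $\sigma((x_n)_n)=(x_{n+1})_n$ is the left shift, and $d$ is a Cantor metric on $\Sigma$: $d(x,y)=\beta^{-\min\{|k|:x_k\ne y_k\}}$ for $x\ne y$ and $d(x,x)=0$, with $\beta>1$ fixed. A subshift is a pair $(X,\sigma)$ with $\emptyset\ne X\subseteq\Sigma$ closed and $\sigma(X)=X$. For $\delta>0$ put $D_\delta(x,y)=\limsup_{n\to\infty}\frac1n\#\{0\le k\le n-1: d(\sigma^k(x),\sigma^k(y))\ge\delta\}$. For $\delta\in(0,1]$ this is a pseudometric on $\Sigma$, and the equivalence relation $D_\delta(x,y)=0$ on $\Sigma$ does not depend on $\delta\in(0,1]$; $[\cdot]$ denotes the quotient map, $[\Sigma]$ the quotient, and $[X]$ the image of $X$. $D_\delta$ induces a metric on $[\Sigma]$, also denoted $D_\delta$. For $\delta>0$, $\nu\in(0,1]$ let $\mathrm{Sep}(\sigma|_X,\delta,\nu)=\sup\{\#Y: Y\subseteq X,\ D_\delta(x,y)\ge\nu \text{ for all } x\ne y\text{ in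 }Y\}$. $(X,\sigma)$ has finite separation numbers if $\mathrm{Sep}(\sigma|_X,\delta,\nu)<\infty$ for all $\delta>0$, $\nu\in(0,1]$ (in this case $[X]$ is totally bounded in $([\Sigma],D_\delta)$ for every $\delta\in(0,1]$). The lower and upper amorphic complexity are $\underline{\mathrm{ac}}(\sigma|_X)=\sup_{\delta>0}\liminf_{\nu\to0}\frac{\log\mathrm{Sep}(\sigma|_X,\delta,\nu)}{-\log\nu}$ and $\overline{\mathrm{ac}}(\sigma|_X)=\sup_{\delta>0}\limsup_{\nu\to0}\frac{\log\mathrm{Sep}(\sigma|_X,\delta,\nu)}{-\log\nu}$. For a totally bounded subset $E$ of a metric space $(M,\rho)$, let $M_\varepsilon(E)$ be the maximal cardinality of a subset $S\subseteq E$ with $\rho(s,s')\ge\varepsilon$ for all $s\ne s'$ in $S$; then $\underline{\dim}_B(E)=\liminf_{\varepsilon\to0}\frac{\log M_\varepsilon(E)}{-\log\varepsilon}$ and $\overline{\dim}_B(E)=\limsup_{\varepsilon\to0}\frac{\log M_\varepsilon(E)}{-\log\varepsilon}$. *)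

theory Defs
  imports "HOL-Analysis.Analysis"
begin

text \<open>The alphabet is a finite type \<open>'a\<close>, and \<open>\<Sigma>\<close> is the type \<open>int \<Rightarrow> 'a\<close>. The
  base \<open>\<beta>\<close> of the Cantor metric is an explicit parameter of everything that depends on it.\<close>

definition shift :: "(int \<Rightarrow> 'a) \<Rightarrow> int \<Rightarrow> 'a"
  where "shift x = (\<lambda>n. x (n + 1))"

definition cantor_dist :: "real \<Rightarrow> (int \<Rightarrow> 'a) \<Rightarrow> (int \<Rightarrow> 'a) \<Rightarrow> real"
  where "cantor_dist \<beta> x y =
    (if x = y then 0 else \<beta> powr - real (Inf {nat \<bar>k\<bar> | k. x k \<noteq> y k}))"

definition subshift :: "(int \<Rightarrow> 'a::finite) set \<Rightarrow> bool"
  where "subshift X \<longleftrightarrow>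
    X \<noteq> {} \<and>
    closedin (product_topology (\<lambda>_::int. discrete_topology (UNIV :: 'a set)) UNIV) X \<and>
    shift ` X = X"

text \<open>The limit superior is taken in the complete lattice of extended reals; it lies in
  \<open>[0,1]\<close> (lemma \<open>ereal_bes_dist\<close> below), so the conversion to a real is harmless.
  The term for \<open>n = 0\<close> is \<open>0 / 0 = 0\<close>.\<close>

definition bes_dist :: "real \<Rightarrow> real \<Rightarrow> (int \<Rightarrow> 'a) \<Rightarrow> (int \<Rightarrow> 'a) \<Rightarrow> real"
  where "bes_dist \<beta> \<delta> x y = real_of_ereal (limsup (\<lambda>n. ereal
    (real (card {k. k < n \<and> \<delta> \<le> cantor_dist \<beta> ((shift ^^ k) x) ((shift ^^ k) y)}) / real n)))"

text \<open>A single \<open>\<delta> \<in> (0,1]\<close> would give the same relation (lemma \<open>bes_rel_iff\<close> below). The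
  quotient is the Besicovitch space \<open>[\<Sigma>]\<close>.\<close>

definition bes_rel :: "real \<Rightarrow> ((int \<Rightarrow> 'a) \<times> (int \<Rightarrow> 'a)) set"
  where "bes_rel \<beta> = {(x, y). \<forall>\<delta>\<in>{0<..1}. bes_dist \<beta> \<delta> x y = 0}"

definition bes_class :: "real \<Rightarrow> (int \<Rightarrow> 'a) \<Rightarrow> (int \<Rightarrow> 'a) set"
  where "bes_class \<beta> x = bes_rel \<beta> `` {x}"

definition bes_space :: "real \<Rightarrow> (int \<Rightarrow> 'a) set set"
  where "bes_space \<beta> = UNIV // bes_rel \<beta>"

text \<open>The metric induced on the quotient, via representatives; lemma
  \<open>bes_quot_dist_class\<close> below shows that their choice does not matter.\<close>

definition bes_quot_dist ::
    "real \<Rightarrow> real \<Rightarrow> (int \<Rightarrow> 'a) set \<Rightarrow> (int \<Rightarrow> 'a) set \<Rightarrow> real"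
  where "bes_quot_dist \<beta> \<delta> P Q = bes_dist \<beta> \<delta> (SOME x. x \<in> P) (SOME y. y \<in> Q)"

definition set_size :: "'b set \<Rightarrow> enat"
  where "set_size S = (if finite S then enat (card S) else \<infinity>)"

definition log_enat :: "enat \<Rightarrow> ereal"
  where "log_enat N = (case N of enat n \<Rightarrow> ereal (ln (real n)) | \<infinity> \<Rightarrow> \<infinity>)"

text \<open>The supremum over all subsets of \<open>E\<close> whose points are pairwise at distance at least
  \<open>\<epsilon>\<close>. If it is finite, as for totally bounded \<open>E\<close>, it is the maximal cardinality of such
  a subset.\<close>

definition sep_number :: "('b \<Rightarrow> 'b \<Rightarrow> real) \<Rightarrow> 'b set \<Rightarrow> real \<Rightarrow> enat"
  where "sep_number \<rho> E \<epsilon> =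
    Sup {set_size S | S. S \<subseteq> E \<and> (\<forall>s\<in>S. \<forall>s'\<in>S. s \<noteq> s' \<longrightarrow> \<epsilon> \<le> \<rho> s s')}"

definition Sep :: "real \<Rightarrow> (int \<Rightarrow> 'a) set \<Rightarrow> real \<Rightarrow> real \<Rightarrow> enat"
  where "Sep \<beta> X \<delta> \<nu> = sep_number (bes_dist \<beta> \<delta>) X \<nu>"

definition finite_separation_numbers :: "real \<Rightarrow> (int \<Rightarrow> 'a) set \<Rightarrow> bool"
  where "finite_separation_numbers \<beta> X \<longleftrightarrow> (\<forall>\<delta>>0. \<forall>\<nu>\<in>{0<..1}. Sep \<beta> X \<delta> \<nu> < \<infinity>)"

definition lower_ac :: "real \<Rightarrow> (int \<Rightarrow> 'a) set \<Rightarrow> ereal"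
  where "lower_ac \<beta> X =
    (SUP \<delta>\<in>{0<..}. Liminf (at_right 0) (\<lambda>\<nu>. log_enat (Sep \<beta> X \<delta> \<nu>) / ereal (- ln \<nu>)))"

definition upper_ac :: "real \<Rightarrow> (int \<Rightarrow> 'a) set \<Rightarrow> ereal"
  where "upper_ac \<beta> X =
    (SUP \<delta>\<in>{0<..}. Limsup (at_right 0) (\<lambda>\<nu>. log_enat (Sep \<beta> X \<delta> \<nu>) / ereal (- ln \<nu>)))"

definition lower_box_dim :: "('b \<Rightarrow> 'b \<Rightarrow> real) \<Rightarrow> 'b set \<Rightarrow> ereal"
  where "lower_box_dim \<rho> E =
    Liminf (at_right 0) (\<lambda>\<epsilon>. log_enat (sep_number \<rho> E \<epsilon>) / ereal (- ln \<epsilon>))"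

definition upper_box_dim :: "('b \<Rightarrow> 'b \<Rightarrow> real) \<Rightarrow> 'b set \<Rightarrow> ereal"
  where "upper_box_dim \<rho> E =
    Limsup (at_right 0) (\<lambda>\<epsilon>. log_enat (sep_number \<rho> E \<epsilon>) / ereal (- ln \<epsilon>))"


section \<open>The quotient is a metric space\<close>

lemma shift_funpow: "(shift ^^ k) x i = x (i + int k)"
  by (induction k arbitrary: i) (auto simp: shift_def algebra_simps)

lemma cantor_dist_ge_iff:
  assumes "\<beta> > 1" "\<delta> > 0"
  shows "\<delta> \<le> cantor_dist \<beta> x y \<longleftrightarrow> (\<exists>k. x k \<noteq> y k \<and> \<delta> \<le> \<beta> powr - real_of_int \<bar>k\<bar>)"
proof (cases "x = y")
  case True
  then show ?thesis using assms by (auto simp: cantor_dist_def)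
next
  case False
  define S where "S = {nat \<bar>k\<bar> | k. x k \<noteq> y k}"
  have "S \<noteq> {}" using False unfolding S_def by blast
  then have "Inf S \<in> S" by (rule Inf_nat_def1)
  then obtain k where k: "Inf S = nat \<bar>k\<bar>" "x k \<noteq> y k" unfolding S_def by blast
  have le: "Inf S \<le> nat \<bar>j\<bar>" if "x j \<noteq> y j" for j
    by (rule cInf_lower) (use that in \<open>auto simp: S_def\<close>)
  have d: "cantor_dist \<beta> x y = \<beta> powr - real (Inf S)"
    using False by (simp add: cantor_dist_def S_def)
  show ?thesis
  proof
    assume "\<delta> \<le> cantor_dist \<beta> x y"
    then show "\<exists>k. x k \<noteq> y k \<and> \<delta> \<le> \<beta> powr - real_of_int \<bar>k\<bar>"
      using d k by (intro exI[of _ k]) simp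
  next
    assume "\<exists>k. x k \<noteq> y k \<and> \<delta> \<le> \<beta> powr - real_of_int \<bar>k\<bar>"
    then obtain j where j: "x j \<noteq> y j" "\<delta> \<le> \<beta> powr - real_of_int \<bar>j\<bar>" by blast
    have "real (Inf S) \<le> real (nat \<bar>j\<bar>)" using le[OF j(1)] by simp
    then have "real (Inf S) \<le> real_of_int \<bar>j\<bar>" by simp
    then have "\<beta> powr - real_of_int \<bar>j\<bar> \<le> \<beta> powr - real (Inf S)"
      using assms by (intro powr_mono) auto
    then show "\<delta> \<le> cantor_dist \<beta> x y" using j d by simp
  qed
qed

definition bes_count :: "real \<Rightarrow> real \<Rightarrow> (int \<Rightarrow> 'a) \<Rightarrow> (int \<Rightarrow> 'a) \<Rightarrow> nat \<Rightarrow> nat"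
  where "bes_count \<beta> \<delta> x y n =
    card {k. k < n \<and> \<delta> \<le> cantor_dist \<beta> ((shift ^^ k) x) ((shift ^^ k) y)}"

lemma bes_count_le: "bes_count \<beta> \<delta> x y n \<le> n"
proof -
  have "bes_count \<beta> \<delta> x y n \<le> card {..<n}"
    unfolding bes_count_def by (intro card_mono) auto
  then show ?thesis by simp
qed

lemma bes_freq_le_1: "real (bes_count \<beta> \<delta> x y n) / real n \<le> 1"
  using bes_count_le[of \<beta> \<delta> x y n] by (cases "n = 0") (auto simp: divide_simps)

lemma limsup_bes_bounds:
  "0 \<le> limsup (\<lambda>n. ereal (real (bes_count \<beta> \<delta> x y n) / real n))"
  "limsup (\<lambda>n. ereal (real (bes_count \<beta> \<delta> x y n) / real n)) \<le> 1"
proof -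
  show "0 \<le> limsup (\<lambda>n. ereal (real (bes_count \<beta> \<delta> x y n) / real n))"
    by (rule le_Limsup) auto
  show "limsup (\<lambda>n. ereal (real (bes_count \<beta> \<delta> x y n) / real n)) \<le> 1"
    by (intro Limsup_bounded always_eventually allI) (simp add: bes_freq_le_1)
qed

lemma ereal_bes_dist:
  "ereal (bes_dist \<beta> \<delta> x y) = limsup (\<lambda>n. ereal (real (bes_count \<beta> \<delta> x y n) / real n))"
  unfolding bes_dist_def bes_count_def[symmetric]
  using limsup_bes_bounds[of \<beta> \<delta> x y]
  by (intro ereal_real') (auto simp: ereal_infty_less_eq)

lemma bes_dist_bounds: "0 \<le> bes_dist \<beta> \<delta> x y" "bes_dist \<beta> \<delta> x y \<le> 1"
  using limsup_bes_bounds[of \<beta> \<delta> x y] unfolding ereal_bes_dist[symmetric]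
  by simp_all

lemma cantor_dist_commute: "cantor_dist \<beta> x y = cantor_dist \<beta> y x"
  by (auto simp: cantor_dist_def eq_commute)

lemma bes_dist_commute: "bes_dist \<beta> \<delta> x y = bes_dist \<beta> \<delta> y x"
  unfolding bes_dist_def by (subst cantor_dist_commute) (rule refl)

lemma bes_dist_self: "\<delta> > 0 \<Longrightarrow> bes_dist \<beta> \<delta> x x = 0"
  by (simp add: bes_dist_def cantor_dist_def Limsup_const zero_ereal_def[symmetric])

lemma bes_count_triangle:
  assumes "\<beta> > 1" "\<delta> > 0"
  shows "bes_count \<beta> \<delta> x z n \<le> bes_count \<beta> \<delta> x y n + bes_count \<beta> \<delta> y z n"
proof -
  let ?S = "\<lambda>x y. {k. k < n \<and> \<delta> \<le> cantor_dist \<beta> ((shift ^^ k) x) ((shift ^^ k) y)}"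
  have "?S x z \<subseteq> ?S x y \<union> ?S y z"
    unfolding cantor_dist_ge_iff[OF assms] 
  proof
    fix k
    assume "k \<in> {k. k < n \<and> (\<exists>i. (shift ^^ k) x i \<noteq> (shift ^^ k) z i \<and> \<delta> \<le> \<beta> powr - real_of_int \<bar>i\<bar>)}"
    then obtain i where i: "k < n" "(shift ^^ k) x i \<noteq> (shift ^^ k) z i"
        "\<delta> \<le> \<beta> powr - real_of_int \<bar>i\<bar>" by blast
    then have "(shift ^^ k) x i \<noteq> (shift ^^ k) y i \<or> (shift ^^ k) y i \<noteq> (shift ^^ k) z i"
      by metis
    with i show "k \<in> {k. k < n \<and> (\<exists>i. (shift ^^ k) x i \<noteq> (shift ^^ k) y i \<and> \<delta> \<le> \<beta> powr - real_of_int \<bar>i\<bar>)} \<union>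
        {k. k < n \<and> (\<exists>i. (shift ^^ k) y i \<noteq> (shift ^^ k) z i \<and> \<delta> \<le> \<beta> powr - real_of_int \<bar>i\<bar>)}"
      by blast
  qed
  then have "card (?S x z) \<le> card (?S x y \<union> ?S y z)"
    by (intro card_mono) auto
  also have "\<dots> \<le> card (?S x y) + card (?S y z)" by (rule card_Un_le)
  finally show ?thesis unfolding bes_count_def .
qed

lemma bes_dist_triangle:
  assumes "\<beta> > 1" "\<delta> > 0"
  shows "bes_dist \<beta> \<delta> x z \<le> bes_dist \<beta> \<delta> x y + bes_dist \<beta> \<delta> y z"
proof -
  let ?f = "\<lambda>x y n. ereal (real (bes_count \<beta> \<delta> x y n) / real n)"
  have "limsup (?f x z) \<le> limsup (\<lambda>n. ?f x y n + ?f y z n)"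
  proof (intro Limsup_mono always_eventually allI)
    fix n
    have "real (bes_count \<beta> \<delta> x z n) \<le> real (bes_count \<beta> \<delta> x y n) + real (bes_count \<beta> \<delta> y z n)"
      using bes_count_triangle[OF assms, of x z n y] by linarith
    then have "real (bes_count \<beta> \<delta> x z n) / real n
        \<le> (real (bes_count \<beta> \<delta> x y n) + real (bes_count \<beta> \<delta> y z n)) / real n"
      by (intro divide_right_mono) auto
    then show "?f x z n \<le> ?f x y n + ?f y z n"
      by (simp add: add_divide_distrib)
  qed
  also have "\<dots> \<le> limsup (?f x y) + limsup (?f y z)"
    by (rule ereal_limsup_add_mono)
  finally show ?thesis unfolding ereal_bes_dist[symmetric] by simp
qed

lemma bes_dist_eq_0_iff:
  "bes_dist \<beta> \<delta> x y = 0 \<longleftrightarrow> (\<lambda>n. real (bes_count \<beta> \<delta> x y n) / real n) \<longlonglongrightarrow> 0"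
proof
  let ?f = "\<lambda>n. real (bes_count \<beta> \<delta> x y n) / real n"
  assume "bes_dist \<beta> \<delta> x y = 0"
  then have s: "limsup (\<lambda>n. ereal (?f n)) = 0"
    using ereal_bes_dist[of \<beta> \<delta> x y] by (simp add: zero_ereal_def)
  have "0 \<le> liminf (\<lambda>n. ereal (?f n))" by (rule Liminf_bounded) auto
  moreover have "liminf (\<lambda>n. ereal (?f n)) \<le> limsup (\<lambda>n. ereal (?f n))"
    by (rule Liminf_le_Limsup) simp
  ultimately have "liminf (\<lambda>n. ereal (?f n)) = 0" using s by simp
  with s have "(\<lambda>n. ereal (?f n)) \<longlonglongrightarrow> 0" by (intro Liminf_eq_Limsup) auto
  then show "?f \<longlonglongrightarrow> 0" by (simp add: zero_ereal_def)
next
  let ?f = "\<lambda>n. real (bes_count \<beta> \<delta> x y n) / real n"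
  assume "?f \<longlonglongrightarrow> 0"
  then have "(\<lambda>n. ereal (?f n)) \<longlonglongrightarrow> ereal 0" by simp
  then have "limsup (\<lambda>n. ereal (?f n)) = ereal 0" by (intro lim_imp_Limsup) auto
  then show "bes_dist \<beta> \<delta> x y = 0"
    using ereal_bes_dist[of \<beta> \<delta> x y] by simp
qed

lemma bes_count_1:
  fixes x y :: "int \<Rightarrow> 'a"
  assumes "\<beta> > 1"
  shows "bes_count \<beta> 1 x y n = card {k. k < n \<and> x (int k) \<noteq> y (int k)}"
proof -
  have "1 \<le> \<beta> powr - real_of_int \<bar>j\<bar> \<longleftrightarrow> j = 0" for j
    using assms powr_le_cancel_iff[of \<beta> 0 "- real_of_int \<bar>j\<bar>"] by simp
  then have "1 \<le> cantor_dist \<beta> u v \<longleftrightarrow> u 0 \<noteq> v 0" for u v :: "int \<Rightarrow> 'a"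
    using cantor_dist_ge_iff[OF assms zero_less_one, of u v] by auto
  then show ?thesis by (simp add: bes_count_def shift_funpow)
qed

lemma bes_count_le_window:
  assumes "\<beta> > 1" "0 < \<delta>"
  obtains m where "\<And>x y n. bes_count \<beta> \<delta> x y n \<le> (2 * m + 1) * (bes_count \<beta> 1 x y n + m)"
proof -
  obtain m :: nat where m: "1 / \<delta> < \<beta> ^ m"
    using assms real_arch_pow by blast
  have small: "\<bar>j\<bar> \<le> int m" if "\<delta> \<le> \<beta> powr - real_of_int \<bar>j\<bar>" for j
  proof (rule ccontr)
    assume "\<not> \<bar>j\<bar> \<le> int m"
    then have "\<beta> powr - real_of_int \<bar>j\<bar> \<le> \<beta> powr - real m"
      using assms by (intro powr_mono) auto
    also have "\<dots> = 1 / \<beta> ^ m"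
      using assms by (simp add: powr_minus powr_realpow divide_inverse)
    also have "\<dots> < \<delta>"
      using m assms by (simp add: field_simps)
    finally show False using that by simp
  qed
  show thesis
  proof (rule that)
    fix x y :: "int \<Rightarrow> 'b" and n
    let ?B = "{k. k < n \<and> x (int k) \<noteq> y (int k)}"
    let ?T = "\<lambda>j. {k. k < n \<and> x (j + int k) \<noteq> y (j + int k)}"
    have one: "card (?T j) \<le> bes_count \<beta> 1 x y n + m" if "j \<in> {- int m..int m}" for j
    proof -
      have "(\<lambda>k. j + int k) ` ?T j \<subseteq> int ` ?B \<union> ({j..<0} \<union> {int n..<int n + j})"
      proof
        fix i assume "i \<in> (\<lambda>k. j + int k) ` ?T j"
        then obtain k where k: "i = j + int k" "k < n" "x i \<noteq> y i" by auto
        show "i \<in> int ` ?B \<union> ({j..<0} \<union> {int n..<int n + j})"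
        proof (cases "0 \<le> i \<and> i < int n")
          case True
          then have "i = int (nat i)" "nat i < n" by auto
          then show ?thesis using k by (intro UnI1 image_eqI[of _ _ "nat i"]) auto
        qed (use k in auto)
      qed
      then have "card ((\<lambda>k. j + int k) ` ?T j)
          \<le> card (int ` ?B \<union> ({j..<0} \<union> {int n..<int n + j}))"
        by (intro card_mono) auto
      moreover have "card (int ` ?B \<union> ({j..<0} \<union> {int n..<int n + j}))
          \<le> card (int ` ?B) + card ({j..<0} \<union> {int n..<int n + j})"
        by (rule card_Un_le)
      moreover have "card ({j..<0} \<union> {int n..<int n + j}) \<le> card {j..<0} + card {int n..<int n + j}"
        by (rule card_Un_le)
      moreover have "card {j..<0} + card {int n..<int n + j} \<le> m" using that by auto
      moreover have "card (int ` ?B) = card ?B" by (intro card_image) auto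
      moreover have "card ((\<lambda>k. j + int k) ` ?T j) = card (?T j)"
        by (intro card_image) (auto simp: inj_on_def)
      moreover note bes_count_1[OF assms(1), of x y n]
      ultimately show ?thesis by linarith
    qed
    have "{k. k < n \<and> \<delta> \<le> cantor_dist \<beta> ((shift ^^ k) x) ((shift ^^ k) y)}
        \<subseteq> (\<Union>j\<in>{- int m..int m}. ?T j)"
    proof
      fix k assume "k \<in> {k. k < n \<and> \<delta> \<le> cantor_dist \<beta> ((shift ^^ k) x) ((shift ^^ k) y)}"
      then obtain j where "k < n" "x (j + int k) \<noteq> y (j + int k)" "\<bar>j\<bar> \<le> int m"
        unfolding cantor_dist_ge_iff[OF assms] shift_funpow using small by blast
      then show "k \<in> (\<Union>j\<in>{- int m..int m}. ?T j)"
        by (intro UN_I[of j]) auto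
    qed
    then have "bes_count \<beta> \<delta> x y n \<le> card (\<Union>j\<in>{- int m..int m}. ?T j)"
      unfolding bes_count_def by (intro card_mono) auto
    also have "\<dots> \<le> (\<Sum>j\<in>{- int m..int m}. card (?T j))"
      by (rule card_UN_le) simp
    also have "\<dots> \<le> (\<Sum>j\<in>{- int m..int m}. bes_count \<beta> 1 x y n + m)"
      by (rule sum_mono) (rule one)
    also have "\<dots> = (2 * m + 1) * (bes_count \<beta> 1 x y n + m)"
      proof -
      have "nat (int m - - int m + 1) = 2 * m + 1" by linarith
      then show ?thesis by (simp only: sum_constant card_atLeastAtMost_int of_nat_id)
    qed
    finally show "bes_count \<beta> \<delta> x y n \<le> (2 * m + 1) * (bes_count \<beta> 1 x y n + m)" .
  qed
qed

lemma bes_dist_eq_0_indep: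
  fixes x y :: "int \<Rightarrow> 'a"
  assumes "\<beta> > 1" "\<delta> \<in> {0<..1}"
  shows "bes_dist \<beta> \<delta> x y = 0 \<longleftrightarrow> bes_dist \<beta> 1 x y = 0"
proof
  assume d: "bes_dist \<beta> \<delta> x y = 0"
  have "bes_count \<beta> 1 x y n \<le> bes_count \<beta> \<delta> x y n" for n
    unfolding bes_count_def using assms by (intro card_mono) auto
  then have "\<bar>real (bes_count \<beta> 1 x y n) / real n\<bar> \<le> real (bes_count \<beta> \<delta> x y n) / real n" for n
    by (simp add: divide_right_mono)
  moreover have "(\<lambda>n. real (bes_count \<beta> \<delta> x y n) / real n) \<longlonglongrightarrow> 0"
    using d by (simp add: bes_dist_eq_0_iff)
  ultimately have "(\<lambda>n. real (bes_count \<beta> 1 x y n) / real n) \<longlonglongrightarrow> 0"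
    by (metis (no_types, lifting) Lim_null_comparison always_eventually real_norm_def)
  then show "bes_dist \<beta> 1 x y = 0" by (simp add: bes_dist_eq_0_iff)
next
  assume d: "bes_dist \<beta> 1 x y = 0"
  obtain m where m: "\<And>x y :: int \<Rightarrow> 'a. \<And>n.
      bes_count \<beta> \<delta> x y n \<le> (2 * m + 1) * (bes_count \<beta> 1 x y n + m)"
    using bes_count_le_window[of \<beta> \<delta>] assms by auto
  let ?g = "\<lambda>n. real (2 * m + 1) * (real (bes_count \<beta> 1 x y n) / real n + real m / real n)"
  have "(\<lambda>n. real (bes_count \<beta> 1 x y n) / real n) \<longlonglongrightarrow> 0"
    using d by (simp add: bes_dist_eq_0_iff)
  then have "?g \<longlonglongrightarrow> real (2 * m + 1) * (0 + 0)"
    by (intro tendsto_intros lim_const_over_n)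
  then have g: "?g \<longlonglongrightarrow> 0" by simp
  have "\<bar>real (bes_count \<beta> \<delta> x y n) / real n\<bar> \<le> ?g n" for n
  proof -
    have "real (bes_count \<beta> \<delta> x y n) \<le> real ((2 * m + 1) * (bes_count \<beta> 1 x y n + m))"
      by (rule of_nat_mono) (rule m)
    then have "real (bes_count \<beta> \<delta> x y n) / real n
        \<le> real ((2 * m + 1) * (bes_count \<beta> 1 x y n + m)) / real n"
      by (rule divide_right_mono) simp
    also have "\<dots> = ?g n" by (simp add: add_divide_distrib[symmetric] ring_distribs)
    finally show ?thesis by simp
  qed
  then have "(\<lambda>n. real (bes_count \<beta> \<delta> x y n) / real n) \<longlonglongrightarrow> 0"
    by (intro Lim_null_comparison[OF _ g] always_eventually allI) simp
  then show "bes_dist \<beta> \<delta> x y = 0" by (simp add: bes_dist_eq_0_iff)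
qed

lemma bes_rel_iff:
  assumes "\<beta> > 1" "\<delta> \<in> {0<..1}"
  shows "(x, y) \<in> bes_rel \<beta> \<longleftrightarrow> bes_dist \<beta> \<delta> x y = 0"
  unfolding bes_rel_def mem_Collect_eq case_prod_conv
  using bes_dist_eq_0_indep[OF assms(1), of _ x y] assms(2) by blast

lemma equiv_bes_rel:
  assumes "\<beta> > 1"
  shows "equiv UNIV (bes_rel \<beta> :: ((int \<Rightarrow> 'a) \<times> (int \<Rightarrow> 'a)) set)"
proof (rule equivI)
  let ?R = "bes_rel \<beta> :: ((int \<Rightarrow> 'a) \<times> (int \<Rightarrow> 'a)) set"
  have iff: "(x, y) \<in> ?R \<longleftrightarrow> bes_dist \<beta> 1 x y = 0" for x y :: "int \<Rightarrow> 'a"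
    using bes_rel_iff[OF assms, of 1] by simp
  show "refl ?R" by (rule refl_onI) (simp add: iff bes_dist_self)
  show "sym ?R" by (rule symI) (simp add: iff bes_dist_commute)
  show "trans ?R"
  proof (rule transI)
    fix x y z :: "int \<Rightarrow> 'a"
    assume "(x, y) \<in> bes_rel \<beta>" "(y, z) \<in> bes_rel \<beta>"
    then show "(x, z) \<in> bes_rel \<beta>"
      using bes_dist_triangle[OF assms, of 1 x z y] bes_dist_bounds(1)[of \<beta> 1 x z]
      by (simp add: iff)
  qed
qed simp

lemma bes_quot_dist_class:
  fixes x y :: "int \<Rightarrow> 'a"
  assumes "\<beta> > 1" "\<delta> \<in> {0<..1}"
  shows "bes_quot_dist \<beta> \<delta> (bes_class \<beta> x) (bes_class \<beta> y) = bes_dist \<beta> \<delta> x y"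
proof -
  have rep: "bes_dist \<beta> \<delta> u (SOME v. v \<in> bes_class \<beta> u) = 0" for u :: "int \<Rightarrow> 'a"
  proof -
    have "u \<in> bes_class \<beta> u"
      using equiv_bes_rel[OF assms(1)] unfolding bes_class_def
      by (rule equiv_class_self) simp
    then have "(SOME v. v \<in> bes_class \<beta> u) \<in> bes_class \<beta> u" by (rule someI[where P = "\<lambda>v. v \<in> bes_class \<beta> u"])
    then have "(u, SOME v. v \<in> bes_class \<beta> u) \<in> bes_rel \<beta>"
      by (simp add: bes_class_def)
    then show ?thesis by (simp only: bes_rel_iff[OF assms])
  qed
  have pos: "\<delta> > 0" using assms by simp
  note tri = bes_dist_triangle[OF assms(1) pos]
  let ?u = "SOME v. v \<in> bes_class \<beta> x" and ?w = "SOME v. v \<in> bes_class \<beta> y"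
  have "bes_dist \<beta> \<delta> x y \<le> bes_dist \<beta> \<delta> ?u ?w"
    using tri[of x y ?u] tri[of ?u y ?w] rep[of x] rep[of y] bes_dist_commute[of \<beta> \<delta> y ?w]
    by linarith
  moreover have "bes_dist \<beta> \<delta> ?u ?w \<le> bes_dist \<beta> \<delta> x y"
    using tri[of ?u ?w x] tri[of x ?w y] rep[of x] rep[of y] bes_dist_commute[of \<beta> \<delta> x ?u]
    by linarith
  ultimately show ?thesis unfolding bes_quot_dist_def by linarith
qed

lemma Metric_space_bes:
  assumes "\<beta> > 1" "\<delta> \<in> {0<..1}"
  shows "Metric_space (bes_space \<beta> :: (int \<Rightarrow> 'a) set set) (bes_quot_dist \<beta> \<delta>)"
proof
  have rng: "\<exists>x. P = bes_class \<beta> x" if "P \<in> bes_space \<beta>" for P :: "(int \<Rightarrow> 'a) set"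
    using that unfolding bes_space_def bes_class_def quotient_def by blast
  fix P Q R :: "(int \<Rightarrow> 'a) set"
  show "0 \<le> bes_quot_dist \<beta> \<delta> P Q" by (simp add: bes_quot_dist_def bes_dist_bounds)
  show "bes_quot_dist \<beta> \<delta> P Q = bes_quot_dist \<beta> \<delta> Q P"
    unfolding bes_quot_dist_def by (rule bes_dist_commute)
  {
    assume "P \<in> bes_space \<beta>" "Q \<in> bes_space \<beta>"
    then obtain x y where xy: "P = bes_class \<beta> x" "Q = bes_class \<beta> y" using rng by blast
    have "P = Q \<longleftrightarrow> (x, y) \<in> bes_rel \<beta>"
      using eq_equiv_class_iff[OF equiv_bes_rel[OF assms(1)], of x y]
      unfolding xy bes_class_def by simp
    then show "bes_quot_dist \<beta> \<delta> P Q = 0 \<longleftrightarrow> P = Q"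
      unfolding xy bes_quot_dist_class[OF assms] bes_rel_iff[OF assms] by simp
  }
  show "bes_quot_dist \<beta> \<delta> P R \<le> bes_quot_dist \<beta> \<delta> P Q + bes_quot_dist \<beta> \<delta> Q R"
    unfolding bes_quot_dist_def by (rule bes_dist_triangle) (use assms in auto)
qed

lemma bes_class_image_subset: "bes_class \<beta> ` X \<subseteq> bes_space \<beta>"
  unfolding bes_space_def bes_class_def by (auto intro: quotientI)

end

theory Submission
  imports Defs
begin

text \<open>If a map \<open>\<phi>\<close> satisfies \<open>\<rho> x y \<le> C * \<rho>' (\<phi> x) (\<phi> y)\<close>, then the box dimensions of its
  domain are at most those of its codomain: such a map carries \<open>\<epsilon>\<close>-separated sets injectively to
  \<open>\<epsilon> / C\<close>-separated ones, and replacing \<open>\<epsilon>\<close> by \<open>\<epsilon> / C\<close> changes \<open>- ln \<epsilon>\<close> by a bounded amount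
  only. Everything follows from this principle (lemma \<open>box_dim_le\<close>).

  It applies in two ways. The quotient map and a choice of representatives both preserve
  distances, so \<open>[X]\<close> and \<open>X\<close> have the same box dimensions with respect to \<open>D\<^sub>\<delta>\<close>. Further,
  \<open>D\<^sub>1 \<le> D\<^sub>\<delta>\<close> for \<open>\<delta> \<le> 1\<close>, whereas \<open>D\<^sub>\<delta> \<le> C * D\<^sub>1\<close> for every \<open>\<delta> > 0\<close> (lemma \<open>bes_dist_le_1\<close>):
  if \<open>\<sigma>\<^sup>k x\<close> and \<open>\<sigma>\<^sup>k y\<close> are \<open>\<delta>\<close>-apart, then \<open>x\<close> and \<open>y\<close> differ at a place within a bounded
  distance of \<open>k\<close>, so each place of difference is counted boundedly often. Hence the
  dimensions do not depend on \<open>\<delta> \<in> (0,1]\<close>. As the inequality \<open>D\<^sub>\<delta> \<le> C * D\<^sub>1\<close> covers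
  \<open>\<delta> > 1\<close> too, the supremum over \<open>\<delta> > 0\<close> that defines amorphic complexity is attained
  at \<open>\<delta> = 1\<close>.\<close>

lemma log_enat_mono:
  assumes "M \<le> N"
  shows "log_enat M \<le> log_enat N"
proof (cases N)
  case (enat n)
  then obtain m where m: "M = enat m" "m \<le> n"
    using assms by (cases M) auto
  show ?thesis
    by (cases "m = 0"; cases "n = 0") (use m enat in \<open>auto simp: log_enat_def\<close>)
qed (simp add: log_enat_def)

lemma log_enat_nonneg: "0 \<le> log_enat N"
proof (cases N)
  case (enat n)
  then show ?thesis by (cases "n = 0") (auto simp: log_enat_def)
qed (simp add: log_enat_def)

text \<open>The supremum defining the separation number is compared set by set; \<open>\<epsilon> > 0\<close> together
  with \<open>\<rho>' p p = 0\<close> makes \<open>\<phi>\<close> injective on separated sets even when \<open>\<rho>\<close> is only a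
  pseudometric.\<close>

lemma sep_number_le:
  assumes "\<epsilon> > 0" "C > 0"
    and maps: "\<phi> ` E \<subseteq> E'"
    and self: "\<And>p. \<rho>' p p = 0"
    and le: "\<And>x y. x \<in> E \<Longrightarrow> y \<in> E \<Longrightarrow> \<rho> x y \<le> C * \<rho>' (\<phi> x) (\<phi> y)"
  shows "sep_number \<rho> E \<epsilon> \<le> sep_number \<rho>' E' (\<epsilon> / C)"
  unfolding sep_number_def[of \<rho>]
proof (rule Sup_least, clarify)
  fix S
  assume S: "S \<subseteq> E" "\<forall>s\<in>S. \<forall>s'\<in>S. s \<noteq> s' \<longrightarrow> \<epsilon> \<le> \<rho> s s'"
  have sep: "\<epsilon> \<le> C * \<rho>' (\<phi> x) (\<phi> y)" if "x \<in> S" "y \<in> S" "x \<noteq> y" for x y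
    using S that le[of x y] by force
  have inj: "inj_on \<phi> S"
  proof (rule inj_onI, rule ccontr)
    fix x y assume "x \<in> S" "y \<in> S" "\<phi> x = \<phi> y" "x \<noteq> y"
    then show False using sep[of x y] self[of "\<phi> y"] assms(1) by simp
  qed
  have "set_size S = set_size (\<phi> ` S)"
    using inj by (simp add: set_size_def card_image finite_image_iff)
  also have "\<dots> \<le> sep_number \<rho>' E' (\<epsilon> / C)"
    unfolding sep_number_def
  proof (rule Sup_upper, rule CollectI, intro exI conjI ballI impI)
    show "\<phi> ` S \<subseteq> E'" using S maps by blast
    fix p q assume "p \<in> \<phi> ` S" "q \<in> \<phi> ` S" "p \<noteq> q"
    then obtain x y where "x \<in> S" "y \<in> S" "x \<noteq> y" "p = \<phi> x" "q = \<phi> y" by blast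
    then show "\<epsilon> / C \<le> \<rho>' p q"
      using sep[of x y] assms(2) by (simp add: divide_le_eq mult.commute)
  qed simp
  finally show "set_size S \<le> sep_number \<rho>' E' (\<epsilon> / C)" .
qed

text \<open>Growth rates on the scale \<open>- ln \<epsilon>\<close> are insensitive to rescaling \<open>\<epsilon>\<close> by a constant. Since
  \<open>ln (\<epsilon> / C) / ln \<epsilon>\<close> tends to \<open>1\<close>, the comparison holds eventually up to any factor
  \<open>z < 1\<close>, and \<open>z\<close> may then tend to \<open>1\<close>.\<close>

lemma log_growth_rate_le:
  fixes f g :: "real \<Rightarrow> ereal"
  assumes "C > 0"
    and f: "\<And>\<epsilon>. 0 \<le> f \<epsilon>"
    and fg: "\<And>\<epsilon>. \<epsilon> > 0 \<Longrightarrow> f \<epsilon> \<le> g (\<epsilon> / C)"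
  shows "Liminf (at_right 0) (\<lambda>\<epsilon>. f \<epsilon> / ereal (- ln \<epsilon>))
      \<le> Liminf (at_right 0) (\<lambda>\<epsilon>. g \<epsilon> / ereal (- ln \<epsilon>))"
    and "Limsup (at_right 0) (\<lambda>\<epsilon>. f \<epsilon> / ereal (- ln \<epsilon>))
      \<le> Limsup (at_right 0) (\<lambda>\<epsilon>. g \<epsilon> / ereal (- ln \<epsilon>))"
proof -
  let ?F = "\<lambda>\<epsilon>. f \<epsilon> / ereal (- ln \<epsilon>)" and ?G = "\<lambda>\<epsilon>. g \<epsilon> / ereal (- ln \<epsilon>)"
  have rescale: "filtermap (\<lambda>\<epsilon>. \<epsilon> / C) (at_right 0) = at_right 0"
    using filtermap_times_pos_at_right[of "inverse C" 0] assms(1)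
    by (simp add: divide_inverse mult.commute[of _ "inverse C"])
  have inj: "inj (\<lambda>\<epsilon>. \<epsilon> / C)"
    using assms(1) by (auto simp: inj_on_def)
  have g: "0 \<le> g \<epsilon>" if "\<epsilon> > 0" for \<epsilon>
    using order.trans[OF f fg[of "C * \<epsilon>"]] that assms(1) by simp
  have "\<forall>\<^sub>F \<epsilon> in at_right 0. 0 \<le> ?G \<epsilon>"
    using eventually_at_right_real[OF zero_less_one]
    by (rule eventually_mono) (auto intro!: zero_le_divide_ereal g)
  then have inf0: "0 \<le> Liminf (at_right 0) ?G"
    by (rule Liminf_bounded)
  then have sup0: "0 \<le> Limsup (at_right 0) ?G"
    using Liminf_le_Limsup[of "at_right 0" ?G] by simp
  have ev: "\<forall>\<^sub>F \<epsilon> in at_right 0. ereal z * ?F \<epsilon> \<le> ?G (\<epsilon> / C)" if z: "0 < z" "z < 1" for z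
  proof -
    \<comment> \<open>Below the first two bounds both logarithms are negative; the third one solves
        \<open>z * (- ln (\<epsilon> / C)) \<le> - ln \<epsilon>\<close> for \<open>\<epsilon>\<close>.\<close>
    define b where "b = min (exp (- 1)) (min (C * exp (- 1)) (exp (- (z * ln C / (1 - z)))))"
    have "b > 0" using assms(1) by (simp add: b_def)
    then have "\<forall>\<^sub>F \<epsilon> in at_right 0. \<epsilon> \<in> {0<..<b}" by (rule eventually_at_right_real)
    then show ?thesis
    proof (rule eventually_mono)
      fix \<epsilon> assume "\<epsilon> \<in> {0<..<b}"
      then have e: "0 < \<epsilon>" "\<epsilon> < exp (- 1)" "\<epsilon> / C < exp (- 1)"
          "\<epsilon> < exp (- (z * ln C / (1 - z)))"
        using assms(1) by (auto simp: b_def divide_less_eq mult.commute)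
      have l: "ln \<epsilon> < - 1" "ln \<epsilon> < - (z * ln C / (1 - z))"
        using ln_less_cancel_iff[of \<epsilon> "exp (- 1)"]
          ln_less_cancel_iff[of \<epsilon> "exp (- (z * ln C / (1 - z)))"] e by simp_all
      have lC: "ln (\<epsilon> / C) < - 1"
        using e assms(1) ln_less_cancel_iff[of "\<epsilon> / C" "exp (- 1)"] by simp
      have "z * ln C < (1 - z) * (- ln \<epsilon>)"
        using l z by (simp add: field_simps)
      then have "z * (- ln (\<epsilon> / C)) \<le> - ln \<epsilon>"
        using e assms(1) by (simp add: ln_div algebra_simps)
      then have "z / (- ln \<epsilon>) \<le> 1 / (- ln (\<epsilon> / C))"
        using l lC by (simp add: field_simps)
      then have "f \<epsilon> * ereal (z / (- ln \<epsilon>)) \<le> f \<epsilon> * ereal (1 / (- ln (\<epsilon> / C)))"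
        by (intro ereal_mult_left_mono f) simp
      also have "\<dots> \<le> g (\<epsilon> / C) * ereal (1 / (- ln (\<epsilon> / C)))"
        using fg[OF e(1)] lC by (intro ereal_mult_right_mono) auto
      also have "\<dots> = ?G (\<epsilon> / C)"
        using lC by (simp add: divide_ereal_def inverse_eq_divide)
      also have "f \<epsilon> * ereal (z / (- ln \<epsilon>)) = ereal z * ?F \<epsilon>"
      proof -
        have "ereal (z / (- ln \<epsilon>)) = ereal z * inverse (ereal (- ln \<epsilon>))"
          using l by (simp add: divide_inverse)
        then show ?thesis by (simp only: divide_ereal_def mult.left_commute)
      qed
      finally show "ereal z * ?F \<epsilon> \<le> ?G (\<epsilon> / C)" .
    qed
  qed
  have "z * Liminf (at_right 0) ?F \<le> Liminf (at_right 0) ?G" if "0 < z" "z < 1" for z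
  proof (cases z)
    case (real r)
    have "ereal r * Liminf (at_right 0) ?F = Liminf (at_right 0) (\<lambda>\<epsilon>. ereal r * ?F \<epsilon>)"
      using that real by (subst Liminf_ereal_mult_left) auto
    also have "\<dots> \<le> Liminf (at_right 0) (\<lambda>\<epsilon>. ?G (\<epsilon> / C))"
      using that real by (intro Liminf_mono ev) auto
    also have "\<dots> = Liminf (filtermap (\<lambda>\<epsilon>. \<epsilon> / C) (at_right 0)) ?G"
      by (rule Liminf_filtermap_eq[OF inj, symmetric])
    finally show ?thesis using real by (simp only: rescale)
  qed (use that in auto)
  then show "Liminf (at_right 0) ?F \<le> Liminf (at_right 0) ?G"
    by (rule ereal_le_mult_one_interval[rotated]) (use inf0 in auto)
  have "z * Limsup (at_right 0) ?F \<le> Limsup (at_right 0) ?G" if "0 < z" "z < 1" for z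
  proof (cases z)
    case (real r)
    have "ereal r * Limsup (at_right 0) ?F = Limsup (at_right 0) (\<lambda>\<epsilon>. ereal r * ?F \<epsilon>)"
      using that real by (subst Limsup_ereal_mult_left) auto
    also have "\<dots> \<le> Limsup (at_right 0) (\<lambda>\<epsilon>. ?G (\<epsilon> / C))"
      using that real by (intro Limsup_mono ev) auto
    also have "\<dots> = Limsup (filtermap (\<lambda>\<epsilon>. \<epsilon> / C) (at_right 0)) ?G"
      by (rule Limsup_filtermap_eq[OF inj, symmetric])
    finally show ?thesis using real by (simp only: rescale)
  qed (use that in auto)
  then show "Limsup (at_right 0) ?F \<le> Limsup (at_right 0) ?G"
    by (rule ereal_le_mult_one_interval[rotated]) (use sup0 in auto)
qed

lemma box_dim_le:
  assumes "C > 0"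
    and "\<phi> ` E \<subseteq> E'"
    and "\<And>p. \<rho>' p p = 0"
    and "\<And>x y. x \<in> E \<Longrightarrow> y \<in> E \<Longrightarrow> \<rho> x y \<le> C * \<rho>' (\<phi> x) (\<phi> y)"
  shows "lower_box_dim \<rho> E \<le> lower_box_dim \<rho>' E'"
    and "upper_box_dim \<rho> E \<le> upper_box_dim \<rho>' E'"
proof -
  have sep: "log_enat (sep_number \<rho> E \<epsilon>) \<le> log_enat (sep_number \<rho>' E' (\<epsilon> / C))" if "\<epsilon> > 0" for \<epsilon>
    using that assms by (intro log_enat_mono sep_number_le)
  show "lower_box_dim \<rho> E \<le> lower_box_dim \<rho>' E'"
    unfolding lower_box_dim_def
    by (rule log_growth_rate_le(1)[where C = C]) (use assms(1) sep log_enat_nonneg in auto)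
  show "upper_box_dim \<rho> E \<le> upper_box_dim \<rho>' E'"
    unfolding upper_box_dim_def
    by (rule log_growth_rate_le(2)[where C = C]) (use assms(1) sep log_enat_nonneg in auto)
qed

lemma bes_dist_antimono:
  assumes "\<delta> \<le> \<delta>'"
  shows "bes_dist \<beta> \<delta>' x y \<le> bes_dist \<beta> \<delta> x y"
proof -
  have "bes_count \<beta> \<delta>' x y n \<le> bes_count \<beta> \<delta> x y n" for n
    unfolding bes_count_def using assms by (intro card_mono) auto
  then have "ereal (bes_dist \<beta> \<delta>' x y) \<le> ereal (bes_dist \<beta> \<delta> x y)"
    unfolding ereal_bes_dist
    by (intro Limsup_mono always_eventually allI) (simp add: divide_right_mono)
  then show ?thesis by simp
qed

text \<open>The constant is the length of a window around \<open>0\<close> that contains every coordinate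
  whose difference makes two sequences \<open>\<delta>\<close>-apart. Window
  positions that stick out of \<open>{0..<n}\<close> contribute a bounded count, which vanishes after
  division by \<open>n\<close>.\<close>

lemma bes_dist_le_1:
  assumes "\<beta> > 1" "\<delta> > 0"
  obtains C where "C > 0" "\<And>x y :: int \<Rightarrow> 'a. bes_dist \<beta> \<delta> x y \<le> C * bes_dist \<beta> 1 x y"
proof -
  obtain m where m: "\<And>x y :: int \<Rightarrow> 'a. \<And>n.
      bes_count \<beta> \<delta> x y n \<le> (2 * m + 1) * (bes_count \<beta> 1 x y n + m)"
    using bes_count_le_window[OF assms] by blast
  let ?C = "real (2 * m + 1)"
  show thesis
  proof (rule that[of ?C])
    fix x y :: "int \<Rightarrow> 'a"
    let ?f = "\<lambda>n. ereal (real (bes_count \<beta> 1 x y n) / real n)"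
    let ?e = "\<lambda>n. ereal (?C * real m / real n)"
    have "ereal (bes_dist \<beta> \<delta> x y) \<le> limsup (\<lambda>n. ereal ?C * ?f n + ?e n)"
      unfolding ereal_bes_dist
    proof (intro Limsup_mono always_eventually allI)
      fix n
      have "real (bes_count \<beta> \<delta> x y n) \<le> real ((2 * m + 1) * (bes_count \<beta> 1 x y n + m))"
        by (rule of_nat_mono) (rule m)
      then have "real (bes_count \<beta> \<delta> x y n) / real n
          \<le> real ((2 * m + 1) * (bes_count \<beta> 1 x y n + m)) / real n"
        by (rule divide_right_mono) simp
      also have "\<dots> = ?C * (real (bes_count \<beta> 1 x y n) / real n) + ?C * real m / real n"
        by (simp add: add_divide_distrib[symmetric] ring_distribs)
      finally show "ereal (real (bes_count \<beta> \<delta> x y n) / real n) \<le> ereal ?C * ?f n + ?e n"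
        by simp
    qed
    also have "\<dots> \<le> limsup (\<lambda>n. ereal ?C * ?f n) + limsup ?e"
      by (rule ereal_limsup_add_mono)
    also have "limsup (\<lambda>n. ereal ?C * ?f n) = ereal ?C * limsup ?f"
      by (rule Limsup_ereal_mult_left) auto
    also have "limsup ?e = ereal 0"
      by (intro lim_imp_Limsup tendsto_ereal lim_const_over_n) simp
    finally show "bes_dist \<beta> \<delta> x y \<le> ?C * bes_dist \<beta> 1 x y"
      by (simp add: ereal_bes_dist[symmetric])
  qed simp
qed

lemma box_dim_bes_le_1:
  assumes "\<beta> > 1" "\<delta> > 0"
  shows "lower_box_dim (bes_dist \<beta> \<delta>) X \<le> lower_box_dim (bes_dist \<beta> 1) X"
    and "upper_box_dim (bes_dist \<beta> \<delta>) X \<le> upper_box_dim (bes_dist \<beta> 1) X"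
proof -
  obtain C where C: "C > 0" "\<And>x y :: int \<Rightarrow> 'a. bes_dist \<beta> \<delta> x y \<le> C * bes_dist \<beta> 1 x y"
    using bes_dist_le_1[OF assms] by blast
  show "lower_box_dim (bes_dist \<beta> \<delta>) X \<le> lower_box_dim (bes_dist \<beta> 1) X"
    and "upper_box_dim (bes_dist \<beta> \<delta>) X \<le> upper_box_dim (bes_dist \<beta> 1) X"
    using C by (auto intro!: box_dim_le[where \<phi> = id and C = C] bes_dist_self)
qed

lemma box_dim_bes_eq_1:
  assumes "\<beta> > 1" "\<delta> \<in> {0<..1}"
  shows "lower_box_dim (bes_dist \<beta> \<delta>) X = lower_box_dim (bes_dist \<beta> 1) X"
    and "upper_box_dim (bes_dist \<beta> \<delta>) X = upper_box_dim (bes_dist \<beta> 1) X"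
proof -
  have "lower_box_dim (bes_dist \<beta> 1) X \<le> lower_box_dim (bes_dist \<beta> \<delta>) X"
    and "upper_box_dim (bes_dist \<beta> 1) X \<le> upper_box_dim (bes_dist \<beta> \<delta>) X"
    using assms by (auto intro!: box_dim_le[where \<phi> = id and C = 1] bes_dist_self bes_dist_antimono)
  then show "lower_box_dim (bes_dist \<beta> \<delta>) X = lower_box_dim (bes_dist \<beta> 1) X"
    and "upper_box_dim (bes_dist \<beta> \<delta>) X = upper_box_dim (bes_dist \<beta> 1) X"
    using box_dim_bes_le_1[OF assms(1), of \<delta> X] assms(2) by auto
qed

lemma box_dim_bes_quot:
  assumes "\<beta> > 1" "\<delta> \<in> {0<..1}"
  shows "lower_box_dim (bes_quot_dist \<beta> \<delta>) (bes_class \<beta> ` X) = lower_box_dim (bes_dist \<beta> \<delta>) X"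
    and "upper_box_dim (bes_quot_dist \<beta> \<delta>) (bes_class \<beta> ` X) = upper_box_dim (bes_dist \<beta> \<delta>) X"
proof -
  let ?r = "inv_into X (bes_class \<beta>)"
  have self: "bes_dist \<beta> \<delta> x x = 0" for x :: "int \<Rightarrow> 'a"
    using assms(2) by (intro bes_dist_self) simp
  have qself: "bes_quot_dist \<beta> \<delta> P P = 0" for P :: "(int \<Rightarrow> 'a) set"
    unfolding bes_quot_dist_def by (rule self)
  have cls: "bes_dist \<beta> \<delta> x y \<le> 1 * bes_quot_dist \<beta> \<delta> (bes_class \<beta> x) (bes_class \<beta> y)"
    for x y :: "int \<Rightarrow> 'a"
    by (simp add: bes_quot_dist_class[OF assms])
  have rep: "bes_quot_dist \<beta> \<delta> P Q \<le> 1 * bes_dist \<beta> \<delta> (?r P) (?r Q)"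
    if "P \<in> bes_class \<beta> ` X" "Q \<in> bes_class \<beta> ` X" for P Q
    using bes_quot_dist_class[OF assms, of "?r P" "?r Q"] that by (simp add: f_inv_into_f)
  have into: "?r ` bes_class \<beta> ` X \<subseteq> X"
    by (auto intro: inv_into_into)
  note le = box_dim_le[where \<phi> = ?r and C = 1 and E = "bes_class \<beta> ` X"
      and \<rho> = "bes_quot_dist \<beta> \<delta>" and \<rho>' = "bes_dist \<beta> \<delta>", OF zero_less_one into self rep]
    and ge = box_dim_le[where \<phi> = "bes_class \<beta>" and C = 1 and E = X and \<rho> = "bes_dist \<beta> \<delta>"
      and \<rho>' = "bes_quot_dist \<beta> \<delta>", OF zero_less_one subset_refl qself cls]
  show "lower_box_dim (bes_quot_dist \<beta> \<delta>) (bes_class \<beta> ` X) = lower_box_dim (bes_dist \<beta> \<delta>) X"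
    by (rule antisym[OF le(1) ge(1)])
  show "upper_box_dim (bes_quot_dist \<beta> \<delta>) (bes_class \<beta> ` X) = upper_box_dim (bes_dist \<beta> \<delta>) X"
    by (rule antisym[OF le(2) ge(2)])
qed

lemma ac_eq_box_dim_1:
  assumes "\<beta> > 1"
  shows "lower_ac \<beta> X = lower_box_dim (bes_dist \<beta> 1) X"
    and "upper_ac \<beta> X = upper_box_dim (bes_dist \<beta> 1) X"
proof -
  have "lower_ac \<beta> X = (SUP \<delta>\<in>{0<..}. lower_box_dim (bes_dist \<beta> \<delta>) X)"
    unfolding lower_ac_def lower_box_dim_def Sep_def ..
  also have "\<dots> = lower_box_dim (bes_dist \<beta> 1) X"
    by (intro antisym SUP_least SUP_upper) (use box_dim_bes_le_1[OF assms] in auto)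
  finally show "lower_ac \<beta> X = lower_box_dim (bes_dist \<beta> 1) X" .
  have "upper_ac \<beta> X = (SUP \<delta>\<in>{0<..}. upper_box_dim (bes_dist \<beta> \<delta>) X)"
    unfolding upper_ac_def upper_box_dim_def Sep_def ..
  also have "\<dots> = upper_box_dim (bes_dist \<beta> 1) X"
    by (intro antisym SUP_least SUP_upper) (use box_dim_bes_le_1[OF assms] in auto)
  finally show "upper_ac \<beta> X = upper_box_dim (bes_dist \<beta> 1) X" .
qed

theorem theorem6p5:
  fixes \<beta> :: real and X :: "(int \<Rightarrow> 'a::finite) set"
  assumes "\<beta> > 1"
    and "subshift X"
    and "finite_separation_numbers \<beta> X"
  shows "(\<forall>\<delta>\<in>{0<..1}. \<forall>\<delta>'\<in>{0<..1}.
        lower_box_dim (bes_quot_dist \<beta> \<delta>) (bes_class \<beta> ` X)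
          = lower_box_dim (bes_quot_dist \<beta> \<delta>') (bes_class \<beta> ` X) \<and>
        upper_box_dim (bes_quot_dist \<beta> \<delta>) (bes_class \<beta> ` X)
          = upper_box_dim (bes_quot_dist \<beta> \<delta>') (bes_class \<beta> ` X)) \<and>
    (\<forall>\<delta>\<in>{0<..1}.
        lower_ac \<beta> X = lower_box_dim (bes_quot_dist \<beta> \<delta>) (bes_class \<beta> ` X) \<and>
        upper_ac \<beta> X = upper_box_dim (bes_quot_dist \<beta> \<delta>) (bes_class \<beta> ` X))"
  by (simp only: box_dim_bes_quot[OF assms(1)] box_dim_bes_eq_1[OF assms(1)]
      ac_eq_box_dim_1[OF assms(1)] simp_thms ball_triv cong: ball_cong)

end
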